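(* Consider a DC network with data $A$, $C_{\ell k}$, $e_k$, $Y_{\ell\ell}$, $Y_{\ell s}$, $Z_{\ell\ell}=Y_{\ell\ell}^{-1}$, load uncertainty set $\mathcal{P}_\ell=\{p_\ell\in\mathbb{R}^{n_\ell}:\underline{p}_\ell\le p_\ell\le\bar{p}_\ell\}$ with $\bar p_\ell\ge 0$, given nominal load profile $p_\ell^*\in\mathbb{R}^{n_\ell}$, convex constraint sets $\mathcal{V}^{\mathrm{ref}}\subset\mathbb{R}^{n_s}$ and $\mathcal{V}_\ell\subset\mathbb{R}^{n_\ell}$, robust stability set $\mathcal{V}^s_\ell$, Jacobian $J(V_\ell,p_\ell)$, and cost function $f:\mathbb{R}^{n_s}\times\mathbb{R}^{n_\ell}\to\mathbb{R}$, all as described in the context. Consider the following two problems. Problem (R. DN-OPF* ): minimize $f(V^{\mathrm{ref}},V_\ell^* )$ over $V^{\mathrm{ref}}\in\mathcal{V}^{\mathrm{ref}}$, $s>0$ and $V_{\ell-},V_{\ell+},V_\ell^*,E\in\mathbb{R}^{n_\ell}$ subject to $$\underline{p}_\ell=\mathrm{diag}\{V_{\ell-}\}(Y_{\ell\ell}V_{\ell-}+Y_{\ell s}V^{\mathrm{ref}}),\qquad \bar{p}_\ell=\mathrm{diag}\{V_{\ell+}\}(Y_{\ell\ell}V_{\ell+}+Y_{\ell s}V^{\mathrm{ref}}),$$ $$E=-Z_{\ell\ell}Y_{\ell s}V^{\mathrm{ref}},\qquad E\le V_{\ell+},\qquad s\mathbf{1}<E,\qquad Z_{\ell\ell}\bar{p}_\ell<s^2\mathbf{1},$$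 $$V_{\ell-}\in\mathcal{V}^s_\ell\cap\mathcal{V}_\ell,\qquad V_{\ell+}\in\mathcal{V}^s_\ell\cap\mathcal{V}_\ell,$$ $$p_\ell^*=\mathrm{diag}\{V_\ell^*\}(Y_{\ell\ell}V_\ell^*+Y_{\ell s}V^{\mathrm{ref}}),\qquad V_\ell^*\in\mathcal{V}_\ell.$$ Problem (R. DN-OPF SIP): minimize $f(V^{\mathrm{ref}},V_\ell^* )$ over $V^{\mathrm{ref}}\in\mathcal{V}^{\mathrm{ref}}$ and symmetric $P\succeq 0$ ($P\in\mathbb{R}^{n\times n}$), with $V_\ell^*$ and a function $p_\ell\mapsto V_\ell(p_\ell)$ as implicit variables, subject to $$p_\ell^*=\mathrm{diag}\{V_\ell^*\}(Y_{\ell\ell}V_\ell^*+Y_{\ell s}V^{\mathrm{ref}}),\qquad V_\ell^*\in\mathcal{V}_\ell,$$ and, for every $p_\ell\in\mathcal{P}_\ell$, $$PJ(V_\ell(p_\ell),p_\ell)+J(V_\ell(p_\ell),p_\ell)^\top P\prec 0,\qquad p_\ell=\mathrm{diag}\{V_\ell(p_\ell)\}(Y_{\ell\ell}V_\ell(p_\ell)+Y_{\ell s}V^{\mathrm{ref}}),\qquad V_\ell(p_\ell)\in\mathcal{V}_\ell.$$ Then any solution of Problem (R. DN-OPF* ) is a feasible point of Problem (R. DN-OPF SIP). That is, if $(V^{\mathrm{ref}},s,V_{\ell-},V_{\ell+},V_\ell^*,E)$ satisfies the constraints of Problem (R. DN-OPF* ) (in particular if it is a minimizer), then there exist a symmetric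 $P\succeq0$ and a function $V_\ell:\mathcal{P}_\ell\to\mathbb{R}^{n_\ell}$ such that $V^{\mathrm{ref}},V_\ell^*,P,V_\ell(\cdot)$ satisfy all constraints of Problem (R. DN-OPF SIP).
   Context: Vector inequalities are element-wise; $\mathbf{1}$ is the all-ones vector; $\mathrm{diag}\{v\}$ is the diagonal matrix with diagonal $v$. For a real square matrix, $M\succ0$ ($\succeq0$) means symmetric positive definite (semidefinite), and $M\prec0$ ($\preceq 0$) means $-M\succ0$ ($\succeq 0$). Network. A DC network has $n_s\geq 1$ source buses, $n_\ell$ load buses and $n_{\mathrm c}$ power lines, the buses forming a connected graph whose edges are the lines; $n=n_s+n_{\mathrm c}+n_\ell$. All resistances, inductances, capacitances ($R_{\mathrm{c}p},L_{\mathrm{c}p}$ for lines, $R_{sk},C_{sk}$ for sources, $R_{\ell j},C_{\ell j}$ for loads) are positive. With line currents $i_{\mathrm c}$, source bus voltages $v_s$, load bus voltages $v_\ell$, source voltage setpoints $V^{\mathrm{ref}}\in\mathbb{R}^{n_s}$ and load power injections $p_\ell\in\mathbb{R}^{n_\ell}$, the dynamics are: for each line $p$ (oriented from bus $a$ to bus $b$), $L_{\mathrm{c}p}\,di_{\mathrm{c}p}/dt=v_a-v_b-R_{\mathrm{c}p}i_{\mathrm{c}p}$; for each source, $C_{sk}\,dv_{sk}/dt=(V^{\mathrm{ref}}_k-v_{sk})/R_{sk}+(\text{net line current into the bus})$; for each load, $C_{\ell j}\,dv_{\ell j}/dt=-v_{\ell j}/R_{\ell j}+(\text{net line current into the bus})+p_{\ell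 j}/v_{\ell j}$. With state $x=[i_{\mathrm c}^\top,v_s^\top,v_\ell^\top]^\top\in\mathbb{R}^n$, $A\in\mathbb{R}^{n\times n}$ is the matrix of the part of the dynamics that is linear in $x$. Let $e_k\in\mathbb{R}^n$ be the vector whose $(n_{\mathrm c}+n_s+k)$-th entry is $1/\sqrt{C_{\ell k}}$ and whose other entries are $0$. For $V_\ell$ with nonzero entries, the Jacobian is $$J(V_\ell,p_\ell)=A-\sum_{k=1}^{n_\ell}\frac{p_{\ell k}}{V_{\ell k}^2}e_ke_k^\top.$$ Power flow. Equilibria satisfy $p_\ell=\mathrm{diag}\{V_\ell\}(Y_{\ell\ell}V_\ell+Y_{\ell s}V^{\mathrm{ref}})$, where, with $G$ the weighted graph Laplacian of the network (weights $1/R_{\mathrm{c}p}$) partitioned into source/load blocks, $R_s=\mathrm{diag}(R_{sk})$, $R_\ell=\mathrm{diag}(R_{\ell j})$, $Y_{\ell\ell}=G_{\ell\ell}+R_\ell^{-1}-G_{\ell s}(G_{ss}+R_s^{-1})^{-1}G_{s\ell}$ and $Y_{\ell s}=G_{\ell s}(G_{ss}+R_s^{-1})^{-1}R_s^{-1}$. In particular $Y_{\ell\ell}$ is symmetric positive definite with nonpositive off-diagonal entries, $Y_{\ell s}$ is entrywise nonpositive, and $Z_{\ell\ell}=Y_{\ell\ell}^{-1}$ is entrywise positive. Constraint sets. $\mathcal{V}^{\mathrm{ref}}\subset\mathbb{R}^{n_s}$ is a convex set and consists of vectors with positive entries. $\mathcal{V}_\ell\subset\mathbb{R}^{n_\ell}$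 is a convex set representing operational requirements on the load voltages (such as upper and lower voltage bounds). Robust stability set. A set $\mathcal{V}^s_\ell=\{V_\ell:\underline{V}^s_{\ell j}\le V_{\ell j}\le\bar{V}^s_{\ell j}\ \forall j\}$ with $0<\underline{V}^s_{\ell j}\le\bar V^s_{\ell j}\le+\infty$ (when $\bar V^s_{\ell j}=+\infty$ the upper bound is absent) is a robust stability set if there exists a single $P\succ0$ with $PJ(V_\ell,p_\ell)+J(V_\ell,p_\ell)^\top P\prec0$ for all $V_\ell\in\mathcal{V}^s_\ell$ and all $p_\ell\in\mathcal{P}_\ell$. The set $\mathcal{V}_\ell^s$ in the claim is a given robust stability set of this form.
   Formalization: The convex set of operational load voltages is also assumed to contain every vector lying componentwise between two of its members (as sets given by voltage bounds do); for two or more loads the claim fails for general convex sets, e.g. a diagonal segment. *)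

theory Defs
  imports "HOL-Analysis.Analysis"
begin

section \<open>Matrices\<close>

definition diag_mat :: "real ^ 'n \<Rightarrow> real ^ 'n ^ 'n" where
  "diag_mat v = (\<chi> i j. if i = j then v $ i else 0)"

definition outer :: "real ^ 'n \<Rightarrow> real ^ 'm \<Rightarrow> real ^ 'm ^ 'n" where
  "outer u v = (\<chi> i j. u $ i * v $ j)"

definition posdef :: "real ^ 'n ^ 'n \<Rightarrow> bool" where
  "posdef M \<longleftrightarrow> transpose M = M \<and> (\<forall>x. x \<noteq> 0 \<longrightarrow> 0 < x \<bullet> (M *v x))"

definition possemidef :: "real ^ 'n ^ 'n \<Rightarrow> bool" where
  "possemidef M \<longleftrightarrow> transpose M = M \<and> (\<forall>x. 0 \<le> x \<bullet> (M *v x))"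

definition negdef :: "real ^ 'n ^ 'n \<Rightarrow> bool" where
  "negdef M \<longleftrightarrow> posdef (- M)"


section \<open>DC networks\<close>

text \<open>
  Lines are indexed by \<open>'c\<close>, source buses by \<open>'s\<close>, load buses by \<open>'l\<close>; a bus is an
  element of \<open>'s + 'l\<close>.  Line \<open>q\<close> is oriented from bus \<open>src N q\<close> to bus \<open>dst N q\<close>;
  parallel lines are allowed, self-loops are not.
\<close>

record ('c::finite, 's::finite, 'l::finite) dc_net =
  src :: "'c \<Rightarrow> 's + 'l"
  dst :: "'c \<Rightarrow> 's + 'l"
  Rc :: "real ^ 'c"
  Lc :: "real ^ 'c"
  Rs :: "real ^ 's"
  Cs :: "real ^ 's"
  Rl :: "real ^ 'l"
  Cl :: "real ^ 'l"

definition adjacency :: "('c::finite, 's::finite, 'l::finite) dc_net \<Rightarrow> ('s + 'l) rel" where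
  "adjacency N = {(a, b). \<exists>q. (src N q = a \<and> dst N q = b) \<or> (src N q = b \<and> dst N q = a)}"

definition dc_network :: "('c::finite, 's::finite, 'l::finite) dc_net \<Rightarrow> bool" where
  "dc_network N \<longleftrightarrow>
     (\<forall>q. src N q \<noteq> dst N q) \<and>
     (\<forall>a b. (a, b) \<in> (adjacency N)\<^sup>*) \<and>
     (\<forall>q. 0 < Rc N $ q \<and> 0 < Lc N $ q) \<and>
     (\<forall>k. 0 < Rs N $ k \<and> 0 < Cs N $ k) \<and>
     (\<forall>j. 0 < Rl N $ j \<and> 0 < Cl N $ j)"


section \<open>Dynamics and Jacobian\<close>

text \<open>
  The state \<open>x = (i\<^sub>c, v\<^sub>s, v\<^sub>l)\<close> is indexed by \<open>'c + ('s + 'l)\<close>, so that \<open>x $ Inr b\<close> is the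
  voltage of bus \<open>b\<close>.
\<close>

definition net_current ::
  "('c::finite, 's::finite, 'l::finite) dc_net \<Rightarrow> real ^ ('c + 's + 'l) \<Rightarrow> 's + 'l \<Rightarrow> real" where
  "net_current N x b = (\<Sum>q | dst N q = b. x $ Inl q) - (\<Sum>q | src N q = b. x $ Inl q)"

text \<open>
  The full vector field adds to \<open>linear_dynamics\<close> the constant terms
  \<open>Vref $ k / (Rs N $ k * Cs N $ k)\<close> at the sources and the nonlinear terms
  \<open>p $ j / (Cl N $ j * x $ Inr (Inr j))\<close> at the loads.
\<close>

definition linear_dynamics ::
  "('c::finite, 's::finite, 'l::finite) dc_net \<Rightarrow> real ^ ('c + 's + 'l) \<Rightarrow> real ^ ('c + 's + 'l)" where
  "linear_dynamics N x = (\<chi> i. case i of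
      Inl q \<Rightarrow> (x $ Inr (src N q) - x $ Inr (dst N q) - Rc N $ q * x $ Inl q) / Lc N $ q
    | Inr (Inl k) \<Rightarrow> (- x $ Inr (Inl k) / Rs N $ k + net_current N x (Inl k)) / Cs N $ k
    | Inr (Inr j) \<Rightarrow> (- x $ Inr (Inr j) / Rl N $ j + net_current N x (Inr j)) / Cl N $ j)"

definition A_mat ::
  "('c::finite, 's::finite, 'l::finite) dc_net \<Rightarrow> real ^ ('c + 's + 'l) ^ ('c + 's + 'l)" where
  "A_mat N = matrix (linear_dynamics N)"

definition e_vec :: "('c::finite, 's::finite, 'l::finite) dc_net \<Rightarrow> 'l \<Rightarrow> real ^ ('c + 's + 'l)" where
  "e_vec N k = axis (Inr (Inr k)) (1 / sqrt (Cl N $ k))"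

text \<open>Meaningful only if all entries of \<open>V\<close> are nonzero.\<close>

definition Jac ::
  "('c::finite, 's::finite, 'l::finite) dc_net \<Rightarrow> real ^ 'l \<Rightarrow> real ^ 'l
     \<Rightarrow> real ^ ('c + 's + 'l) ^ ('c + 's + 'l)" where
  "Jac N V p = A_mat N -
     (\<Sum>k\<in>UNIV. (p $ k / (V $ k)\<^sup>2) *\<^sub>R outer (e_vec N k) (e_vec N k))"


section \<open>Power flow\<close>

definition laplacian ::
  "('c::finite, 's::finite, 'l::finite) dc_net \<Rightarrow> real ^ ('s + 'l) ^ ('s + 'l)" where
  "laplacian N = (\<chi> a b.
     if a = b then (\<Sum>q | src N q = a \<or> dst N q = a. 1 / Rc N $ q)
     else - (\<Sum>q | (src N q = a \<and> dst N q = b) \<or> (src N q = b \<and> dst N q = a). 1 / Rc N $ q))"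

definition G_ss :: "('c::finite, 's::finite, 'l::finite) dc_net \<Rightarrow> real ^ 's ^ 's" where
  "G_ss N = (\<chi> i j. laplacian N $ Inl i $ Inl j)"

definition G_sl :: "('c::finite, 's::finite, 'l::finite) dc_net \<Rightarrow> real ^ 'l ^ 's" where
  "G_sl N = (\<chi> i j. laplacian N $ Inl i $ Inr j)"

definition G_ls :: "('c::finite, 's::finite, 'l::finite) dc_net \<Rightarrow> real ^ 's ^ 'l" where
  "G_ls N = (\<chi> i j. laplacian N $ Inr i $ Inl j)"

definition G_ll :: "('c::finite, 's::finite, 'l::finite) dc_net \<Rightarrow> real ^ 'l ^ 'l" where
  "G_ll N = (\<chi> i j. laplacian N $ Inr i $ Inr j)"

definition Y_ll :: "('c::finite, 's::finite, 'l::finite) dc_net \<Rightarrow> real ^ 'l ^ 'l" where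
  "Y_ll N = G_ll N + matrix_inv (diag_mat (Rl N))
     - G_ls N ** matrix_inv (G_ss N + matrix_inv (diag_mat (Rs N))) ** G_sl N"

definition Y_ls :: "('c::finite, 's::finite, 'l::finite) dc_net \<Rightarrow> real ^ 's ^ 'l" where
  "Y_ls N = G_ls N ** matrix_inv (G_ss N + matrix_inv (diag_mat (Rs N)))
     ** matrix_inv (diag_mat (Rs N))"

definition Z_ll :: "('c::finite, 's::finite, 'l::finite) dc_net \<Rightarrow> real ^ 'l ^ 'l" where
  "Z_ll N = matrix_inv (Y_ll N)"

definition power_flow ::
  "('c::finite, 's::finite, 'l::finite) dc_net \<Rightarrow> real ^ 's \<Rightarrow> real ^ 'l \<Rightarrow> real ^ 'l \<Rightarrow> bool" where
  "power_flow N Vref p V \<longleftrightarrow> p = diag_mat V *v (Y_ll N *v V + Y_ls N *v Vref)"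


section \<open>Robust stability sets\<close>

definition robust_stability_set ::
  "('c::finite, 's::finite, 'l::finite) dc_net \<Rightarrow> (real ^ 'l) set \<Rightarrow> (real ^ 'l) set \<Rightarrow> bool" where
  "robust_stability_set N Pl S \<longleftrightarrow>
     (\<exists>(lo :: 'l \<Rightarrow> real) (hi :: 'l \<Rightarrow> ereal).
        (\<forall>j. 0 < lo j \<and> ereal (lo j) \<le> hi j) \<and>
        S = {V. \<forall>j. lo j \<le> V $ j \<and> ereal (V $ j) \<le> hi j}) \<and>
     (\<exists>P. posdef P \<and>
        (\<forall>V\<in>S. \<forall>p\<in>Pl. negdef (P ** Jac N V p + transpose (Jac N V p) ** P)))"


section \<open>The two optimization problems\<close>

text \<open>
  Vector \<open>\<le>\<close> is componentwise; the componentwise strict inequalities are written out, because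
  the library's strict order on vectors is \<open>x \<le> y \<and> \<not> y \<le> x\<close>.
  The decision variables of the first problem are \<open>(Vref, s, Vm, Vp, Vnom, E)\<close>, where \<open>Vm\<close>,
  \<open>Vp\<close>, \<open>Vnom\<close> belong to the load profiles \<open>pmin\<close>, \<open>pmax\<close>, \<open>pnom\<close>.
\<close>

definition opf_star_feasible ::
  "('c::finite, 's::finite, 'l::finite) dc_net \<Rightarrow> real ^ 'l \<Rightarrow> real ^ 'l \<Rightarrow> real ^ 'l
     \<Rightarrow> (real ^ 's) set \<Rightarrow> (real ^ 'l) set \<Rightarrow> (real ^ 'l) set
     \<Rightarrow> (real ^ 's) \<times> real \<times> (real ^ 'l) \<times> (real ^ 'l) \<times> (real ^ 'l) \<times> (real ^ 'l) \<Rightarrow> bool" where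
  "opf_star_feasible N pmin pmax pnom VrefSet VlSet VsSet = (\<lambda>(Vref, s, Vm, Vp, Vnom, E).
     Vref \<in> VrefSet \<and> 0 < s \<and>
     power_flow N Vref pmin Vm \<and>
     power_flow N Vref pmax Vp \<and>
     E = - (Z_ll N *v (Y_ls N *v Vref)) \<and>
     E \<le> Vp \<and>
     (\<forall>j. s < E $ j) \<and>
     (\<forall>j. (Z_ll N *v pmax) $ j < s\<^sup>2) \<and>
     Vm \<in> VsSet \<inter> VlSet \<and>
     Vp \<in> VsSet \<inter> VlSet \<and>
     power_flow N Vref pnom Vnom \<and>
     Vnom \<in> VlSet)"

definition opf_star_solution ::
  "('c::finite, 's::finite, 'l::finite) dc_net \<Rightarrow> real ^ 'l \<Rightarrow> real ^ 'l \<Rightarrow> real ^ 'l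
     \<Rightarrow> (real ^ 's) set \<Rightarrow> (real ^ 'l) set \<Rightarrow> (real ^ 'l) set \<Rightarrow> ((real ^ 's) \<times> (real ^ 'l) \<Rightarrow> real)
     \<Rightarrow> (real ^ 's) \<times> real \<times> (real ^ 'l) \<times> (real ^ 'l) \<times> (real ^ 'l) \<times> (real ^ 'l) \<Rightarrow> bool" where
  "opf_star_solution N pmin pmax pnom VrefSet VlSet VsSet f =
     is_arg_min (\<lambda>(Vref, s, Vm, Vp, Vnom, E). f (Vref, Vnom))
       (opf_star_feasible N pmin pmax pnom VrefSet VlSet VsSet)"

text \<open>
  \<open>Vl\<close> is constrained on \<open>{pmin..pmax}\<close> only.  Its entries are required to be nonzero there,
  so that the Jacobian is meaningful.
\<close>

definition sip_feasible ::
  "('c::finite, 's::finite, 'l::finite) dc_net \<Rightarrow> real ^ 'l \<Rightarrow> real ^ 'l \<Rightarrow> real ^ 'l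
     \<Rightarrow> (real ^ 's) set \<Rightarrow> (real ^ 'l) set
     \<Rightarrow> real ^ 's \<Rightarrow> real ^ 'l \<Rightarrow> real ^ ('c + 's + 'l) ^ ('c + 's + 'l) \<Rightarrow> (real ^ 'l \<Rightarrow> real ^ 'l)
     \<Rightarrow> bool" where
  "sip_feasible N pmin pmax pnom VrefSet VlSet Vref Vnom P Vl \<longleftrightarrow>
     Vref \<in> VrefSet \<and> possemidef P \<and>
     power_flow N Vref pnom Vnom \<and> Vnom \<in> VlSet \<and>
     (\<forall>p\<in>{pmin..pmax}.
        (\<forall>j. Vl p $ j \<noteq> 0) \<and>
        negdef (P ** Jac N (Vl p) p + transpose (Jac N (Vl p) p) ** P) \<and>
        power_flow N Vref p (Vl p) \<and>
        Vl p \<in> VlSet)"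

end

theory Submission
  imports Defs
begin

text \<open>
  Every load profile between the extreme ones has an equilibrium between the extreme equilibria.
  Write \<open>b = Y\<^sub>l\<^sub>s V\<^sup>r\<^sup>e\<^sup>f\<close>.  Eliminating the source buses from the
  grounded Laplacian leaves in \<open>Y\<^sub>l\<^sub>l\<close> a matrix with nonpositive off-diagonal entries and
  positive row sums (\<open>dominant_Z_mat_Y_ll\<close>), and such matrices obey a discrete maximum
  principle (\<open>dominant_Z_mat_max_principle\<close>).

  Let \<open>p\<close> be a load profile between \<open>pmin\<close> and \<open>pmax\<close>.  For positive voltages the power flow
  equation reads \<open>Y\<^sub>l\<^sub>l V + b = p / V\<close> componentwise.  Where \<open>Vm\<close> exceeds \<open>Vp\<close>, one has
  \<open>pmin / Vm \<le> pmax / Vm \<le> pmax / Vp\<close> because \<open>pmax \<ge> 0\<close>, so the maximum principle applied to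
  \<open>Vm - Vp\<close> gives \<open>Vm \<le> Vp\<close>.  Moreover \<open>Vm\<close> is a subsolution and \<open>Vp\<close> a supersolution of
  the equation for \<open>p\<close>, and the method of sub- and supersolutions
  (\<open>power_flow_between_sub_super\<close>) yields a solution \<open>V p\<close> with \<open>Vm \<le> V p \<le> Vp\<close>.  The robust
  stability set is a box and the operational set is closed under componentwise intermediate
  vectors, so both contain \<open>V p\<close>, and the Lyapunov matrix of the robust stability set serves
  as \<open>P\<close>.
\<close>

section \<open>Z-matrices with positive row sums\<close>

text \<open>Strictly diagonally dominant Z-matrices, phrased by row sums.\<close>

definition dominant_Z_mat :: "real ^ 'n ^ 'n \<Rightarrow> bool" where
  "dominant_Z_mat M \<longleftrightarrow>
     (\<forall>i j. i \<noteq> j \<longrightarrow> M $ i $ j \<le> 0) \<and> (\<forall>i. 0 < (\<Sum>j\<in>UNIV. M $ i $ j))"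

text \<open>
  At an index \<open>i\<close> where \<open>d\<close> attains a positive maximum, \<open>(M *v d) $ i\<close> is at least
  \<open>d $ i\<close> times the \<open>i\<close>-th row sum.
\<close>

lemma dominant_Z_mat_max_principle:
  fixes M :: "real ^ 'n ^ 'n"
  assumes M: "dominant_Z_mat M"
    and le: "\<And>i. 0 < d $ i \<Longrightarrow> (M *v d) $ i \<le> 0"
  shows "d $ k \<le> 0"
proof (rule ccontr)
  assume "\<not> d $ k \<le> 0"
  then have k: "0 < d $ k" by simp
  obtain i where i: "\<And>j. d $ j \<le> d $ i"
    using ex_is_arg_min_if_finite[of UNIV "\<lambda>j. - d $ j"] by (auto simp: is_arg_min_linorder)
  have pos: "0 < d $ i" using i[of k] k by simp
  have "(\<Sum>j\<in>UNIV. M $ i $ j) * d $ i = (\<Sum>j\<in>UNIV. M $ i $ j * d $ i)"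
    by (simp add: sum_distrib_right)
  also have "\<dots> \<le> (\<Sum>j\<in>UNIV. M $ i $ j * d $ j)"
  proof (rule sum_mono)
    fix j
    show "M $ i $ j * d $ i \<le> M $ i $ j * d $ j"
      using M i[of j] by (cases "j = i") (auto simp: dominant_Z_mat_def mult_left_mono_neg)
  qed
  also have "\<dots> = (M *v d) $ i"
    by (simp add: matrix_vector_mult_def)
  finally have "(\<Sum>j\<in>UNIV. M $ i $ j) * d $ i \<le> 0"
    using le[OF pos] by simp
  moreover have "0 < (\<Sum>j\<in>UNIV. M $ i $ j) * d $ i"
    using M pos by (simp add: dominant_Z_mat_def)
  ultimately show False by simp
qed

lemma matrix_vector_mult_uminus:
  fixes M :: "real ^ 'n ^ 'm"
  shows "M *v (- x) = - (M *v x)"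
  by (simp add: matrix_vector_mult_def vec_eq_iff sum_negf)

lemma dominant_Z_mat_invertible:
  fixes M :: "real ^ 'n ^ 'n"
  assumes M: "dominant_Z_mat M"
  shows "invertible M"
proof -
  have "d = 0" if "M *v d = 0" for d
  proof -
    have "d $ k \<le> 0" for k
      using dominant_Z_mat_max_principle[OF M, of d] that by simp
    moreover have "M *v (- d) = 0"
      using that by (simp add: matrix_vector_mult_uminus)
    then have "(- d) $ k \<le> 0" for k
      using dominant_Z_mat_max_principle[OF M, of "- d"] by simp
    ultimately show ?thesis
      by (simp add: vec_eq_iff order_antisym)
  qed
  then show ?thesis
    by (simp add: invertible_left_inverse matrix_left_invertible_ker)
qed

lemma matrix_inv_mult:
  fixes M :: "real ^ 'n ^ 'n"
  assumes "invertible M"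
  shows "M *v (matrix_inv M *v x) = x" "matrix_inv M *v (M *v x) = x"
proof -
  have "M ** matrix_inv M = mat 1 \<and> matrix_inv M ** M = mat 1"
    using assms unfolding invertible_def matrix_inv_def by (rule someI_ex)
  then show "M *v (matrix_inv M *v x) = x" "matrix_inv M *v (M *v x) = x"
    by (simp_all add: matrix_vector_mul_assoc)
qed

lemma dominant_Z_mat_inv_nonneg:
  fixes M :: "real ^ 'n ^ 'n"
  assumes M: "dominant_Z_mat M" and x: "\<And>i. 0 \<le> x $ i"
  shows "0 \<le> (matrix_inv M *v x) $ k"
proof -
  let ?d = "- (matrix_inv M *v x)"
  have "M *v ?d = - x"
    using matrix_inv_mult(1)[OF dominant_Z_mat_invertible[OF M], of x]
    by (simp add: matrix_vector_mult_uminus)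
  then have "?d $ k \<le> 0"
    using dominant_Z_mat_max_principle[OF M, of ?d] x by simp
  then show ?thesis by simp
qed

lemma diag_mat_mult: "(diag_mat v *v w) $ j = v $ j * w $ j"
  by (simp add: diag_mat_def matrix_vector_mult_def mult_delta_left)

lemma matrix_inv_diag_mat:
  fixes v :: "real ^ 'n"
  assumes "\<And>i. v $ i \<noteq> 0"
  shows "matrix_inv (diag_mat v) = diag_mat (\<chi> i. 1 / v $ i)"
proof -
  have "diag_mat v ** diag_mat (\<chi> i. 1 / v $ i) = mat 1"
    using assms by (simp add: matrix_eq matrix_vector_mul_assoc[symmetric] vec_eq_iff diag_mat_mult)
  moreover from this have "invertible (diag_mat v)"
    by (auto simp: invertible_right_inverse)
  ultimately have "matrix_inv (diag_mat v) *v x = diag_mat (\<chi> i. 1 / v $ i) *v x" for x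
    by (metis matrix_inv_mult(2) matrix_vector_mul_assoc matrix_vector_mul_lid)
  then show ?thesis
    by (simp add: matrix_eq)
qed

section \<open>The load admittance matrix\<close>

lemma laplacian_offdiag_nonpos:
  assumes "dc_network N" and "a \<noteq> b"
  shows "laplacian N $ a $ b \<le> 0"
proof -
  have "0 \<le> 1 / Rc N $ q" for q
    using assms(1) by (simp add: dc_network_def less_imp_le)
  then show ?thesis
    using assms(2) by (simp add: laplacian_def sum_nonneg)
qed

text \<open>
  The Laplacian is \<open>B R\<^sub>c\<^sup>-\<^sup>1 B\<^sup>T\<close> for the incidence matrix \<open>B\<close>, whose columns sum to zero.
\<close>

lemma laplacian_row_sum:
  fixes N :: "('c::finite, 's::finite, 'l::finite) dc_net"
  assumes N: "dc_network N"
  shows "(\<Sum>b\<in>UNIV. laplacian N $ a $ b) = 0"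
proof -
  define c :: "'c \<Rightarrow> 's + 'l \<Rightarrow> real"
    where "c q b = of_bool (src N q = b) - of_bool (dst N q = b)" for q b
  have ne: "src N q \<noteq> dst N q" for q
    using N by (simp add: dc_network_def)
  have filt: "(\<Sum>q | P q. 1 / Rc N $ q) = (\<Sum>q\<in>UNIV. of_bool (P q) / Rc N $ q)" for P
    by (rule sum.mono_neutral_cong_left) auto
  have lap: "laplacian N $ a $ b = (\<Sum>q\<in>UNIV. c q a * c q b / Rc N $ q)" for b
  proof (cases "a = b")
    case True
    have "of_bool (src N q = a \<or> dst N q = a) = c q a * c q a" for q
      using ne[of q] by (auto simp: c_def)
    with True show ?thesis by (simp add: laplacian_def filt)
  next
    case False
    have "of_bool ((src N q = a \<and> dst N q = b) \<or> (src N q = b \<and> dst N q = a))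
        = - (c q a * c q b)" for q
      using ne[of q] False by (auto simp: c_def)
    with False show ?thesis
      by (simp add: laplacian_def filt sum_negf)
  qed
  have c0: "(\<Sum>b\<in>UNIV. c q b) = 0" for q
    by (simp add: c_def sum_subtractf of_bool_def)
  have "(\<Sum>b\<in>UNIV. laplacian N $ a $ b)
      = (\<Sum>q\<in>UNIV. \<Sum>b\<in>UNIV. c q a * c q b / Rc N $ q)"
    unfolding lap by (rule sum.swap)
  also have "\<dots> = (\<Sum>q\<in>UNIV. c q a * (\<Sum>b\<in>UNIV. c q b) / Rc N $ q)"
    by (simp add: sum_distrib_left sum_divide_distrib)
  finally show ?thesis by (simp add: c0)
qed

lemma laplacian_row_sum_blocks:
  assumes "dc_network N"
  shows "(\<Sum>k\<in>UNIV. laplacian N $ a $ Inl k) + (\<Sum>j\<in>UNIV. laplacian N $ a $ Inr j) = 0"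
proof -
  have "(\<Sum>b\<in>UNIV. laplacian N $ a $ b)
      = (\<Sum>k\<in>UNIV. laplacian N $ a $ Inl k) + (\<Sum>j\<in>UNIV. laplacian N $ a $ Inr j)"
    by (simp add: UNIV_Plus_UNIV[symmetric] sum.Plus del: UNIV_Plus_UNIV)
  then show ?thesis
    using laplacian_row_sum[OF assms, of a] by simp
qed

lemma dominant_Z_mat_source_block:
  assumes N: "dc_network N"
  shows "dominant_Z_mat (G_ss N + matrix_inv (diag_mat (Rs N)))"
proof -
  have R: "0 < Rs N $ k" for k
    using N by (simp add: dc_network_def)
  have inv: "matrix_inv (diag_mat (Rs N)) = diag_mat (\<chi> k. 1 / Rs N $ k)"
    by (rule matrix_inv_diag_mat) (metis R less_irrefl)
  have "0 < (\<Sum>j\<in>UNIV. (G_ss N + diag_mat (\<chi> k. 1 / Rs N $ k)) $ i $ j)" for i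
  proof -
    have "(\<Sum>j\<in>UNIV. laplacian N $ Inl i $ Inr j) \<le> 0"
      by (intro sum_nonpos laplacian_offdiag_nonpos[OF N]) simp
    then have "0 \<le> (\<Sum>j\<in>UNIV. laplacian N $ Inl i $ Inl j)"
      using laplacian_row_sum_blocks[OF N, of "Inl i"] by linarith
    moreover have "0 < 1 / Rs N $ i" using R by simp
    ultimately show ?thesis
      by (simp add: G_ss_def diag_mat_def sum.distrib sum.delta add_nonneg_pos)
  qed
  then show ?thesis
    by (simp add: dominant_Z_mat_def inv)
      (simp add: G_ss_def diag_mat_def laplacian_offdiag_nonpos[OF N])
qed

text \<open>
  With \<open>M = G\<^sub>s\<^sub>s + R\<^sub>s\<^sup>-\<^sup>1\<close>, vanishing Laplacian row sums give
  \<open>G\<^sub>s\<^sub>l 1 = R\<^sub>s\<^sup>-\<^sup>1 1 - M 1\<close>, and so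
  \<open>Y\<^sub>l\<^sub>l 1 = R\<^sub>l\<^sup>-\<^sup>1 1 - G\<^sub>l\<^sub>s M\<^sup>-\<^sup>1 R\<^sub>s\<^sup>-\<^sup>1 1\<close>.  This is positive
  since \<open>G\<^sub>l\<^sub>s \<le> 0 \<le> M\<^sup>-\<^sup>1\<close> entrywise.  Likewise \<open>G\<^sub>l\<^sub>s M\<^sup>-\<^sup>1 G\<^sub>s\<^sub>l\<close>, which is
  subtracted, has nonnegative entries, so the off-diagonal entries of \<open>Y\<^sub>l\<^sub>l\<close> are
  nonpositive.
\<close>

lemma dominant_Z_mat_Y_ll:
  fixes N :: "('c::finite, 's::finite, 'l::finite) dc_net"
  assumes N: "dc_network N"
  shows "dominant_Z_mat (Y_ll N)"
proof -
  define M where "M = G_ss N + matrix_inv (diag_mat (Rs N))"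
  have M: "dominant_Z_mat M"
    unfolding M_def by (rule dominant_Z_mat_source_block[OF N])
  have Rl: "0 < Rl N $ j" and Rs: "0 < Rs N $ k" for j k
    using N by (simp_all add: dc_network_def)
  have inv_Rl: "matrix_inv (diag_mat (Rl N)) = diag_mat (\<chi> k. 1 / Rl N $ k)"
    by (rule matrix_inv_diag_mat) (metis Rl less_irrefl)
  have inv_Rs: "matrix_inv (diag_mat (Rs N)) = diag_mat (\<chi> k. 1 / Rs N $ k)"
    by (rule matrix_inv_diag_mat) (metis Rs less_irrefl)
  have Gls: "G_ls N $ j $ k \<le> 0" for j k
    by (simp add: G_ls_def laplacian_offdiag_nonpos[OF N])
  have Gls_mult: "(G_ls N *v x) $ j \<le> 0" if "\<And>k. 0 \<le> x $ k" for x j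
    unfolding matrix_vector_mult_def
    using that Gls by (simp add: sum_nonpos mult_nonpos_nonneg)
  have Y: "Y_ll N = G_ll N + diag_mat (\<chi> k. 1 / Rl N $ k) - G_ls N ** matrix_inv M ** G_sl N"
    by (simp add: Y_ll_def M_def inv_Rl)
  have off: "Y_ll N $ i $ j \<le> 0" if "i \<noteq> j" for i j
  proof -
    have "0 \<le> (- column j (G_sl N)) $ k" for k
      by (simp add: column_def G_sl_def laplacian_offdiag_nonpos[OF N])
    then have "(G_ls N *v (matrix_inv M *v (- column j (G_sl N)))) $ i \<le> 0"
      by (intro Gls_mult dominant_Z_mat_inv_nonneg[OF M])
    then have "0 \<le> (G_ls N *v (matrix_inv M *v column j (G_sl N))) $ i"
      by (simp add: matrix_vector_mult_uminus)
    moreover have "(G_ls N ** matrix_inv M ** G_sl N) $ i $ j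
        = (G_ls N *v (matrix_inv M *v column j (G_sl N))) $ i"
      by (simp add: matrix_vector_mul_assoc)
        (simp add: matrix_matrix_mult_def matrix_vector_mult_def column_def)
    moreover have "G_ll N $ i $ j \<le> 0"
      using that by (simp add: G_ll_def laplacian_offdiag_nonpos[OF N])
    ultimately show ?thesis
      using that by (simp add: Y diag_mat_def)
  qed
  define r :: "real ^ 's" where "r = (\<chi> k. 1 / Rs N $ k)"
  have "G_sl N *v 1 = r - M *v 1"
  proof -
    have "(G_sl N *v 1) $ k + (M *v 1) $ k = r $ k" for k
      using laplacian_row_sum_blocks[OF N, of "Inl k"]
      by (simp add: matrix_vector_mult_def G_sl_def M_def G_ss_def inv_Rs r_def sum.distrib)
        (simp add: diag_mat_def sum.delta)
    then show ?thesis by (simp add: vec_eq_iff algebra_simps)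
  qed
  then have "matrix_inv M *v (G_sl N *v 1) = matrix_inv M *v r - 1"
    by (simp add: matrix_vector_mult_diff_distrib
        matrix_inv_mult(2)[OF dominant_Z_mat_invertible[OF M]])
  then have elim: "(G_ls N ** matrix_inv M ** G_sl N) *v 1
      = G_ls N *v (matrix_inv M *v r) - G_ls N *v 1"
    by (simp add: matrix_vector_mul_assoc[symmetric] matrix_vector_mult_diff_distrib)
  have row: "0 < (\<Sum>j\<in>UNIV. Y_ll N $ i $ j)" for i
  proof -
    have "(G_ls N *v (matrix_inv M *v r)) $ i \<le> 0"
      by (intro Gls_mult dominant_Z_mat_inv_nonneg[OF M]) (simp add: r_def less_imp_le Rs)
    moreover have "(G_ll N *v 1) $ i + (G_ls N *v 1) $ i = 0"
      using laplacian_row_sum_blocks[OF N, of "Inr i"]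
      by (simp add: matrix_vector_mult_def G_ll_def G_ls_def)
    moreover have "(diag_mat (\<chi> k. 1 / Rl N $ k) *v 1) $ i = 1 / Rl N $ i"
      by (simp add: diag_mat_mult)
    moreover have "0 < 1 / Rl N $ i" using Rl by simp
    moreover have "(Y_ll N *v 1) $ i = (G_ll N *v 1) $ i + (diag_mat (\<chi> k. 1 / Rl N $ k) *v 1) $ i
        - ((G_ls N *v (matrix_inv M *v r)) $ i - (G_ls N *v 1) $ i)"
      by (simp add: Y matrix_vector_mult_diff_rdistrib matrix_vector_mult_add_rdistrib elim)
    ultimately have "0 < (Y_ll N *v 1) $ i" by linarith
    then show ?thesis by (simp add: matrix_vector_mult_def)
  qed
  show ?thesis
    using off row by (simp add: dominant_Z_mat_def)
qed

section \<open>Sub- and supersolutions of the power flow equation\<close>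

text \<open>
  A sufficiently short explicit Euler step for \<open>dV/dt = p / V - Y V - b\<close> is a monotone map on
  the box between \<open>a\<close> and \<open>c\<close>, and moves \<open>a\<close> upwards and \<open>c\<close> downwards.  It thus maps the box
  into itself, and its Brouwer fixed points solve the equation.
\<close>

lemma power_flow_between_sub_super:
  fixes Y :: "real ^ 'n ^ 'n" and a b c p :: "real ^ 'n"
  assumes Z: "\<And>i j. i \<noteq> j \<Longrightarrow> Y $ i $ j \<le> 0"
    and a0: "\<And>j. 0 < a $ j" and ac: "a \<le> c"
    and sub: "\<And>j. (Y *v a + b) $ j \<le> p $ j / a $ j"
    and super: "\<And>j. p $ j / c $ j \<le> (Y *v c + b) $ j"
  obtains V where "V \<in> {a..c}" "\<And>j. V $ j * (Y *v V + b) $ j = p $ j"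
proof -
  \<comment> \<open>\<open>1 / K\<close> is the step length: \<open>K\<close> bounds the slope of \<open>(Y V)\<^sub>j - p\<^sub>j / V\<^sub>j\<close> in \<open>V\<^sub>j\<close> on the box.\<close>
  define K where "K = 1 + (\<Sum>j\<in>UNIV. \<bar>p $ j\<bar> / (a $ j)\<^sup>2 + \<bar>Y $ j $ j\<bar>)"
  define F :: "real ^ 'n \<Rightarrow> real ^ 'n"
    where "F V = (\<chi> j. V $ j + (p $ j / V $ j - (Y *v V + b) $ j) / K)" for V
  have Kj: "\<bar>p $ j\<bar> / (a $ j)\<^sup>2 + \<bar>Y $ j $ j\<bar> \<le> K" for j
  proof -
    have "\<bar>p $ j\<bar> / (a $ j)\<^sup>2 + \<bar>Y $ j $ j\<bar> \<le> (\<Sum>j\<in>UNIV. \<bar>p $ j\<bar> / (a $ j)\<^sup>2 + \<bar>Y $ j $ j\<bar>)"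
      by (rule member_le_sum) auto
    then show ?thesis by (simp add: K_def)
  qed
  have K0: "0 < K"
    unfolding K_def by (rule add_pos_nonneg) (auto intro!: sum_nonneg)
  have mono: "F x \<le> F y" if "a \<le> x" "x \<le> y" for x y
  proof (unfold less_eq_vec_def, intro allI)
    fix j
    have x: "a $ j \<le> x $ j" and xy: "x $ i \<le> y $ i" for i
      using that by (simp_all add: less_eq_vec_def)
    have aj: "0 < a $ j" by (rule a0)
    have xj: "0 < x $ j" and yj: "0 < y $ j" using aj x xy[of j] by simp_all
    have "p $ j / x $ j - p $ j / y $ j = p $ j * (y $ j - x $ j) / (x $ j * y $ j)"
      using xj yj by (simp add: field_simps)
    also have "\<dots> \<le> \<bar>p $ j\<bar> * (y $ j - x $ j) / (x $ j * y $ j)"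
      using xj yj xy[of j] by (intro divide_right_mono mult_right_mono) auto
    also have "\<dots> \<le> \<bar>p $ j\<bar> * (y $ j - x $ j) / (a $ j)\<^sup>2"
    proof (rule divide_left_mono)
      show "(a $ j)\<^sup>2 \<le> x $ j * y $ j"
        unfolding power2_eq_square using aj x xy[of j] by (intro mult_mono) auto
    qed (use aj xj yj xy[of j] in auto)
    finally have 1: "p $ j / x $ j - p $ j / y $ j \<le> \<bar>p $ j\<bar> / (a $ j)\<^sup>2 * (y $ j - x $ j)"
      by simp
    have "(Y *v y) $ j - (Y *v x) $ j = (\<Sum>i\<in>UNIV. Y $ j $ i * (y $ i - x $ i))"
      by (simp add: matrix_vector_mult_def right_diff_distrib sum_subtractf)
    also have "\<dots> = Y $ j $ j * (y $ j - x $ j) + (\<Sum>i\<in>UNIV - {j}. Y $ j $ i * (y $ i - x $ i))"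
      by (simp add: sum.remove)
    also have "\<dots> \<le> \<bar>Y $ j $ j\<bar> * (y $ j - x $ j) + 0"
      using Z xy by (intro add_mono mult_right_mono sum_nonpos) (auto intro!: mult_nonpos_nonneg)
    finally have 2: "(Y *v y) $ j - (Y *v x) $ j \<le> \<bar>Y $ j $ j\<bar> * (y $ j - x $ j)" by simp
    have 3: "(\<bar>p $ j\<bar> / (a $ j)\<^sup>2 + \<bar>Y $ j $ j\<bar>) * (y $ j - x $ j) \<le> K * (y $ j - x $ j)"
      using Kj[of j] xy[of j] by (intro mult_right_mono) auto
    show "F x $ j \<le> F y $ j"
    proof -
      have "K * (F y $ j - F x $ j) = K * (y $ j - x $ j)
          - (p $ j / x $ j - p $ j / y $ j) - ((Y *v y) $ j - (Y *v x) $ j)"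
        using K0 by (simp add: F_def divide_simps) (simp add: algebra_simps)
      then have "0 \<le> K * (F y $ j - F x $ j)"
        using 1 2 3 by (simp add: algebra_simps)
      then show ?thesis
        using K0 by (simp add: zero_le_mult_iff)
    qed
  qed
  have Fa: "a \<le> F a"
    using sub K0 by (auto simp: F_def less_eq_vec_def)
  have Fc: "F c \<le> c"
    using super K0 by (auto simp: F_def less_eq_vec_def divide_le_0_iff)
  have "F ` {a..c} \<subseteq> {a..c}"
  proof (intro image_subsetI)
    fix x
    assume x: "x \<in> {a..c}"
    then have "F a \<le> F x" "F x \<le> F c" using mono by auto
    with Fa Fc show "F x \<in> {a..c}" by (meson atLeastAtMost_iff order_trans)
  qed
  moreover have "continuous_on {a..c} F"
  proof -
    have "V $ j \<noteq> 0" if "V \<in> {a..c}" for V j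
      using that a0[of j] by (auto simp: less_eq_vec_def dest!: spec[of _ j])
    then show ?thesis
      unfolding F_def using K0
      by (intro continuous_intros) auto
  qed
  moreover have "compact {a..c}" "convex {a..c}" "{a..c} \<noteq> {}"
    using ac by (simp_all add: cbox_interval[symmetric]) (simp add: cbox_interval)
  ultimately obtain V where V: "V \<in> {a..c}" "F V = V"
    using brouwer[of "{a..c}" F] by blast
  have "V $ j * (Y *v V + b) $ j = p $ j" for j
  proof -
    have "0 < V $ j"
      using V(1) a0[of j] by (auto simp: less_eq_vec_def intro: less_le_trans)
    moreover have "F V $ j = V $ j" by (simp add: V(2))
    then have "p $ j / V $ j = (Y *v V + b) $ j"
      using K0 by (simp add: F_def)
    ultimately show ?thesis by (simp add: field_simps)
  qed
  with V(1) show ?thesis by (rule that)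
qed

section \<open>Feasibility for every load profile\<close>

lemma power_flow_iff:
  "power_flow N Vref p V \<longleftrightarrow> (\<forall>j. V $ j * (Y_ll N *v V + Y_ls N *v Vref) $ j = p $ j)"
  by (auto simp: power_flow_def vec_eq_iff diag_mat_mult)

lemma power_flow_solutions_ordered:
  assumes N: "dc_network N" and "0 \<le> pmax" "pmin \<le> pmax"
    and m: "power_flow N Vref pmin Vm" "\<And>j. 0 < Vm $ j"
    and p: "power_flow N Vref pmax Vp" "\<And>j. 0 < Vp $ j"
  shows "Vm \<le> Vp"
proof -
  have "(Vm - Vp) $ k \<le> 0" for k
  proof (rule dominant_Z_mat_max_principle[OF dominant_Z_mat_Y_ll[OF N]])
    fix j
    assume d: "0 < (Vm - Vp) $ j"
    have "(Y_ll N *v Vm + Y_ls N *v Vref) $ j = pmin $ j / Vm $ j"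
      using m by (metis power_flow_iff less_irrefl nonzero_mult_div_cancel_left)
    also have "\<dots> \<le> pmax $ j / Vm $ j"
      using assms(3) m(2)[of j] by (simp add: less_eq_vec_def divide_right_mono)
    also have "\<dots> \<le> pmax $ j / Vp $ j"
      using assms(2) d p(2)[of j] by (intro divide_left_mono) (auto simp: less_eq_vec_def)
    also have "\<dots> = (Y_ll N *v Vp + Y_ls N *v Vref) $ j"
      using p by (metis power_flow_iff less_irrefl nonzero_mult_div_cancel_left)
    finally show "(Y_ll N *v (Vm - Vp)) $ j \<le> 0"
      by (simp add: matrix_vector_mult_diff_distrib)
  qed
  then show ?thesis by (simp add: less_eq_vec_def)
qed

lemma power_flow_solution_between:
  assumes N: "dc_network N" and "0 \<le> pmax" and q: "q \<in> {pmin..pmax}"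
    and m: "power_flow N Vref pmin Vm" "\<And>j. 0 < Vm $ j"
    and p: "power_flow N Vref pmax Vp" "\<And>j. 0 < Vp $ j"
  obtains V where "V \<in> {Vm..Vp}" "power_flow N Vref q V"
proof -
  have "pmin \<le> pmax" using q by auto
  then have le: "Vm \<le> Vp"
    using power_flow_solutions_ordered[OF N assms(2) _ m p] by blast
  show ?thesis
  proof (rule power_flow_between_sub_super[of "Y_ll N" Vm Vp "Y_ls N *v Vref" q])
    show "Y_ll N $ i $ j \<le> 0" if "i \<noteq> j" for i j
      using dominant_Z_mat_Y_ll[OF N] that by (simp add: dominant_Z_mat_def)
    show "0 < Vm $ j" for j by (rule m(2))
    show "Vm \<le> Vp" by (rule le)
    show "(Y_ll N *v Vm + Y_ls N *v Vref) $ j \<le> q $ j / Vm $ j" for j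
    proof -
      have "(Y_ll N *v Vm + Y_ls N *v Vref) $ j = pmin $ j / Vm $ j"
        using m by (metis power_flow_iff less_irrefl nonzero_mult_div_cancel_left)
      then show ?thesis
        using q m(2)[of j] by (simp add: less_eq_vec_def divide_right_mono)
    qed
    show "q $ j / Vp $ j \<le> (Y_ll N *v Vp + Y_ls N *v Vref) $ j" for j
    proof -
      have "(Y_ll N *v Vp + Y_ls N *v Vref) $ j = pmax $ j / Vp $ j"
        using p by (metis power_flow_iff less_irrefl nonzero_mult_div_cancel_left)
      then show ?thesis
        using q p(2)[of j] by (simp add: less_eq_vec_def divide_right_mono)
    qed
    fix V
    assume "V \<in> {Vm..Vp}" "\<And>j. V $ j * (Y_ll N *v V + Y_ls N *v Vref) $ j = q $ j"
    then show thesis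
      using that[of V] by (simp add: power_flow_iff)
  qed
qed

lemma robust_stability_set_pos:
  assumes "robust_stability_set N Pl S" "V \<in> S"
  shows "0 < V $ j"
  using assms unfolding robust_stability_set_def by (blast intro: less_le_trans)

lemma robust_stability_set_interval:
  assumes "robust_stability_set N Pl S" "u \<in> S" "w \<in> S"
  shows "{u..w} \<subseteq> S"
proof -
  obtain lo :: "_ \<Rightarrow> real" and hi :: "_ \<Rightarrow> ereal"
    where S: "S = {V. \<forall>j. lo j \<le> V $ j \<and> ereal (V $ j) \<le> hi j}"
    using assms(1) unfolding robust_stability_set_def by blast
  have "lo j \<le> V $ j \<and> ereal (V $ j) \<le> hi j" if "u \<le> V" "V \<le> w" for V j
  proof
    show "lo j \<le> V $ j"
      using assms(2) that(1) unfolding S less_eq_vec_def by (blast intro: order_trans)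
    have "ereal (V $ j) \<le> ereal (w $ j)"
      using that(2) by (simp add: less_eq_vec_def)
    also have "\<dots> \<le> hi j"
      using assms(3) unfolding S by blast
    finally show "ereal (V $ j) \<le> hi j" .
  qed
  then show ?thesis unfolding S by auto
qed

lemma opf_star_feasible_imp_sip_feasible:
  assumes N: "dc_network N" and "0 \<le> pmax"
    and Vl: "\<And>u w. u \<in> VlSet \<Longrightarrow> w \<in> VlSet \<Longrightarrow> {u..w} \<subseteq> VlSet"
    and rs: "robust_stability_set N {pmin..pmax} VsSet"
    and feas: "opf_star_feasible N pmin pmax pnom VrefSet VlSet VsSet (Vref, s, Vm, Vp, Vnom, E)"
  shows "\<exists>P Vl. sip_feasible N pmin pmax pnom VrefSet VlSet Vref Vnom P Vl"
proof -
  have m: "power_flow N Vref pmin Vm" "Vm \<in> VsSet" "Vm \<in> VlSet"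
    and p: "power_flow N Vref pmax Vp" "Vp \<in> VsSet" "Vp \<in> VlSet"
    and nom: "Vref \<in> VrefSet" "power_flow N Vref pnom Vnom" "Vnom \<in> VlSet"
    using feas by (auto simp: opf_star_feasible_def)
  obtain P where P: "posdef P"
    and stable: "\<And>V q. V \<in> VsSet \<Longrightarrow> q \<in> {pmin..pmax} \<Longrightarrow>
      negdef (P ** Jac N V q + transpose (Jac N V q) ** P)"
    using rs unfolding robust_stability_set_def by blast
  have "0 \<le> x \<bullet> (P *v x)" for x
    using P by (cases "x = 0") (auto simp: posdef_def less_imp_le)
  then have semi: "possemidef P"
    using P by (simp add: posdef_def possemidef_def)
  have "\<exists>V. V \<in> {Vm..Vp} \<and> power_flow N Vref q V" if "q \<in> {pmin..pmax}" for q
    using power_flow_solution_between[OF N assms(2) that m(1) _ p(1)]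
      robust_stability_set_pos[OF rs] m(2) p(2) by blast
  then obtain W where W: "\<And>q. q \<in> {pmin..pmax} \<Longrightarrow> W q \<in> {Vm..Vp} \<and> power_flow N Vref q (W q)"
    by metis
  have "W q \<in> VsSet \<and> W q \<in> VlSet" if "q \<in> {pmin..pmax}" for q
    using W[OF that] Vl[OF m(3) p(3)] robust_stability_set_interval[OF rs m(2) p(2)] by blast
  moreover from this have "W q $ j \<noteq> 0" if "q \<in> {pmin..pmax}" for q j
    using robust_stability_set_pos[OF rs] that by (metis less_irrefl)
  ultimately have "sip_feasible N pmin pmax pnom VrefSet VlSet Vref Vnom P W"
    unfolding sip_feasible_def using nom semi stable W by blast
  then show ?thesis by blast
qed

theorem theorem1:
  fixes N :: "('c::finite, 's::finite, 'l::finite) dc_net"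
    and pmin pmax pnom :: "real ^ 'l"
    and VrefSet :: "(real ^ 's) set"
    and VlSet VsSet :: "(real ^ 'l) set"
    and f :: "(real ^ 's) \<times> (real ^ 'l) \<Rightarrow> real"
  assumes "dc_network N"
    and "0 \<le> pmax"
    and "convex VrefSet"
    and "\<And>v k. v \<in> VrefSet \<Longrightarrow> 0 < v $ k"
    and "convex VlSet"
    \<comment> \<open>closed under componentwise intermediate vectors, as are sets given by voltage bounds;
        for two or more loads the claim fails for arbitrary convex \<open>VlSet\<close>\<close>
    and "\<And>u w. u \<in> VlSet \<Longrightarrow> w \<in> VlSet \<Longrightarrow> {u..w} \<subseteq> VlSet"
    and "robust_stability_set N {pmin..pmax} VsSet"
  shows
    "(\<forall>Vref s Vm Vp Vnom E.
        opf_star_feasible N pmin pmax pnom VrefSet VlSet VsSet (Vref, s, Vm, Vp, Vnom, E) \<longrightarrow>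
        (\<exists>P Vl. sip_feasible N pmin pmax pnom VrefSet VlSet Vref Vnom P Vl)) \<and>
     (\<forall>Vref s Vm Vp Vnom E.
        opf_star_solution N pmin pmax pnom VrefSet VlSet VsSet f (Vref, s, Vm, Vp, Vnom, E) \<longrightarrow>
        (\<exists>P Vl. sip_feasible N pmin pmax pnom VrefSet VlSet Vref Vnom P Vl))"
  using opf_star_feasible_imp_sip_feasible[OF assms(1,2,6,7)]
  by (auto simp: opf_star_solution_def is_arg_min_def)

end
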